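(* Let $p$ be a prime, and let $M$ be a $p$-adic monoid with $\mathcal{A}(M) = \{r_n : n \in \mathbb{N}\}$ and $\lim_{n \to \infty} r_n = 0$. If $M$ is atomic, then $\lim_{n \to \infty} \mathsf{n}(r_n) = \infty$ (in particular, the set $\mathsf{n}(\mathcal{A}(M)) = \{\mathsf{n}(a) : a \in \mathcal{A}(M)\}$ is not bounded).
   Context: A Puiseux monoid is an additive submonoid of $\mathbb{Q}_{\ge 0}$. For a prime $p$, let $\mathbb{N}_0[1/p] = \{f(1/p) : f(x) \in \mathbb{N}_0[x]\}$; a $p$-adic monoid is a submonoid of the additive monoid $\mathbb{N}_0[1/p]$. For a positive rational $q$, $\mathsf{n}(q)$ and $\mathsf{d}(q)$ denote the unique relatively prime positive integers with $q = \mathsf{n}(q)/\mathsf{d}(q)$. An atom of a Puiseux monoid $M$ is an element $a \in M \setminus \{0\}$ such that $a = b+c$ with $b,c \in M$ implies $b=0$ or $c=0$; $\mathcal{A}(M)$ is the set of atoms of $M$. The monoid $M$ is atomic if every nonzero element of $M$ is a finite sum of atoms (repetitions allowed). Here $\mathbb{N} = \{1,2,3,\dots\}$ and $\mathbb{N}_0 = \mathbb{N} \cup \{0\}$. *)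

theory Defs
  imports Complex_Main "HOL-Library.Multiset" "HOL-Computational_Algebra.Computational_Algebra"
begin

definition additive_submonoid :: "'a::comm_monoid_add set \<Rightarrow> 'a set \<Rightarrow> bool" where
  "additive_submonoid M N \<longleftrightarrow>
     M \<subseteq> N \<and> 0 \<in> M \<and> (\<forall>x\<in>M. \<forall>y\<in>M. x + y \<in> M)"

text \<open>The monoid \<open>\<nat>\<^sub>0[1/p]\<close> of all values \<open>f(1/p)\<close>, where \<open>f\<close> is a polynomial
  with coefficients in the natural numbers (including zero).\<close>

definition padic_ambient :: "nat \<Rightarrow> rat set" where
  "padic_ambient p = {poly (map_poly of_nat f) (1 / of_nat p) | f :: nat poly. True}"

definition padic_monoid :: "nat \<Rightarrow> rat set \<Rightarrow> bool" where
  "padic_monoid p M \<longleftrightarrow> additive_submonoid M (padic_ambient p)"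

definition atoms :: "'a::comm_monoid_add set \<Rightarrow> 'a set" where
  "atoms M = {a \<in> M - {0}. \<forall>b\<in>M. \<forall>c\<in>M. a = b + c \<longrightarrow> b = 0 \<or> c = 0}"

definition atomic_monoid :: "'a::comm_monoid_add set \<Rightarrow> bool" where
  "atomic_monoid M \<longleftrightarrow>
     (\<forall>x\<in>M - {0}. \<exists>A :: 'a multiset. set_mset A \<subseteq> atoms M \<and> x = sum_mset A)"

text \<open>\<open>quotient_of\<close> returns the pair of coprime numerator and denominator, with
  positive denominator; for positive \<open>q\<close> the numerator is positive as well.\<close>

definition numer :: "rat \<Rightarrow> int" where
  "numer q = fst (quotient_of q)"

end

theory Submission
  imports Defs
begin

text \<open>All elements of \<open>M\<close> have a power of \<open>p\<close> as denominator, so of two distinct atoms with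
  the same numerator the larger one would be a proper multiple of the smaller one.  Hence the
  numerator is injective on atoms, only finitely many atoms have a numerator below a given bound,
  and a null sequence of atoms leaves every finite set of atoms.\<close>

text \<open>Horner's rule: prepending a coefficient divides the previous value by \<open>p\<close>
  and adds a natural number, so the exponent grows by one. The fraction need not be reduced.\<close>

lemma padic_ambient_fraction:
  assumes "p > 0" and "x \<in> padic_ambient p"
  obtains a k :: nat where "x = of_nat a / of_nat p ^ k"
proof -
  have "\<exists>a k :: nat. poly (map_poly of_nat f) (1 / of_nat p) = (of_nat a / of_nat p ^ k :: rat)"
    for f :: "nat poly"
  proof (induction f)
    case 0
    show ?case by (rule exI[of _ 0]) simp
  next
    case (pCons c f)
    then obtain a k :: nat
      where IH: "poly (map_poly of_nat f) (1 / of_nat p) = (of_nat a / of_nat p ^ k :: rat)"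
      by blast
    have "poly (map_poly of_nat (pCons c f)) (1 / of_nat p)
        = (of_nat c + of_nat a / of_nat p ^ k / of_nat p :: rat)"
      using IH by (simp add: map_poly_pCons)
    also have "\<dots> = of_nat (c * p ^ Suc k + a) / of_nat p ^ Suc k"
      using assms(1) by (simp add: field_simps)
    finally show ?case by blast
  qed
  then show thesis
    using assms(2) that unfolding padic_ambient_def by blast
qed

lemma padic_ambient_nonneg: "x \<in> padic_ambient p \<Longrightarrow> p > 0 \<Longrightarrow> x \<ge> 0"
  by (erule padic_ambient_fraction[rotated]) auto

text \<open>The reduced denominator divides some \<open>p ^ k\<close> times the numerator; by
  coprimality it divides \<open>p ^ k\<close> itself, and as \<open>p\<close> is prime it is a power
  of \<open>p\<close>.\<close>

lemma padic_ambient_numer_over_power: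
  assumes "prime p" and "x \<in> padic_ambient p"
  obtains j where "x = of_int (numer x) / of_nat p ^ j"
proof -
  obtain n d where q: "quotient_of x = (n, d)" by fastforce
  have d: "d > 0" "coprime n d" "x = of_int n / of_int d"
    using q quotient_of_denom_pos quotient_of_coprime quotient_of_div by blast+
  have "p > 0" using assms(1) by (simp add: prime_gt_0_nat)
  then obtain a k :: nat where "x = of_nat a / of_nat p ^ k"
    using assms(2) padic_ambient_fraction by blast
  then have "of_int (n * int p ^ k) = (of_int (int a * d) :: rat)"
    using d \<open>p > 0\<close> by (simp add: field_simps)
  then have "n * int p ^ k = int a * d" by (simp only: of_int_eq_iff)
  then have "d dvd n * int p ^ k" by simp
  then have "d dvd int p ^ k"
    using d(2) by (metis coprime_commute coprime_dvd_mult_right_iff)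
  moreover have "prime (int p)" using assms(1) by simp
  \<comment> \<open>Divisors of a prime power are powers only up to sign; \<open>d > 0\<close> then
    removes the normalization.\<close>
  ultimately obtain j where "normalize d = normalize (int p ^ j)"
    using divides_primepow_weak by blast
  then have "d = int p ^ j" using d(1) by simp
  then have "x = of_int (numer x) / of_nat p ^ j"
    using d(3) q unfolding numer_def by simp
  then show thesis by (rule that)
qed

lemma additive_submonoid_of_nat_mult:
  fixes x :: "'a::semiring_1"
  assumes "additive_submonoid M N" and "x \<in> M"
  shows "of_nat k * x \<in> M"
  using assms by (induction k) (auto simp: additive_submonoid_def distrib_right)

text \<open>Since x is nonzero, so are \<open>k\<close> and \<open>y\<close>. Splitting off one copy
  of \<open>y\<close> leaves an element of \<open>M\<close>, which must vanish because x is an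
  atom.\<close>

lemma atom_eq_of_nat_mult:
  fixes x y :: rat
  assumes "additive_submonoid M N" and "x \<in> atoms M" and "y \<in> M" and "x = of_nat k * y"
  shows "x = y"
proof -
  have "x \<noteq> 0" using assms(2) by (simp add: atoms_def)
  then obtain l where k: "k = Suc l"
    using assms(4) by (cases k) auto
  have "of_nat l * y \<in> M"
    using assms additive_submonoid_of_nat_mult by blast
  moreover have "x = y + of_nat l * y"
    using assms(4) k by (simp add: distrib_right)
  ultimately have "of_nat l * y = 0"
    using assms(2,3,4) \<open>x \<noteq> 0\<close> unfolding atoms_def by fastforce
  then show ?thesis using \<open>x = y + of_nat l * y\<close> by simp
qed

lemma inj_on_numer_atoms:
  assumes "prime p" and "padic_monoid p M"
  shows "inj_on numer (atoms M)"
proof -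
  have sub: "additive_submonoid M (padic_ambient p)"
    using assms(2) by (simp add: padic_monoid_def)
  have M: "x \<in> M \<and> x \<in> padic_ambient p" if "x \<in> atoms M" for x
    using that sub by (auto simp: atoms_def additive_submonoid_def)
  have p: "p > 0" using assms(1) by (simp add: prime_gt_0_nat)
  \<comment> \<open>The smaller exponent belongs to the larger fraction, so only the atom property
    of \<open>x\<close> is used. Both orders of the exponents reduce to this case by swapping the
    atoms.\<close>
  have eq: "x = y" if "x \<in> atoms M" "y \<in> atoms M" and "i \<le> j"
    and "x = of_int m / of_nat p ^ i" and "y = of_int m / of_nat p ^ j" for x y m i j
  proof -
    have "(of_nat p :: rat) ^ j = of_nat p ^ (j - i) * of_nat p ^ i"
      using that(3) by (simp flip: power_add)
    then have "x = of_nat (p ^ (j - i)) * y"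
      unfolding that(4,5) using p by simp
    with sub that(1) M[OF that(2)] show ?thesis
      by (blast intro: atom_eq_of_nat_mult)
  qed
  show ?thesis
  proof (rule inj_onI)
    fix x y assume atoms: "x \<in> atoms M" "y \<in> atoms M" and numer: "numer x = numer y"
    obtain i where i: "x = of_int (numer x) / of_nat p ^ i"
      using padic_ambient_numer_over_power[OF assms(1)] M[OF atoms(1)] by blast
    obtain j where j: "y = of_int (numer x) / of_nat p ^ j"
      unfolding numer using padic_ambient_numer_over_power[OF assms(1)] M[OF atoms(2)] by blast
    show "x = y"
    proof (rule linorder_le_cases[of i j])
      assume "i \<le> j"
      from eq[OF atoms this i j] show ?thesis .
    next
      assume "j \<le> i"
      from eq[OF atoms(2,1) this j i] show ?thesis by (rule sym)
    qed
  qed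
qed

lemma numer_pos:
  assumes "x > 0"
  shows "numer x > 0"
proof -
  obtain n d where q: "quotient_of x = (n, d)" by fastforce
  then have "d > 0" "x = of_int n / of_int d"
    using quotient_of_denom_pos quotient_of_div by blast+
  then show ?thesis
    using assms q by (simp add: numer_def zero_less_divide_iff)
qed

theorem theorem5p3:
  fixes p :: nat and M :: "rat set" and r :: "nat \<Rightarrow> rat"
  assumes "prime p"
    and "padic_monoid p M"
    and "atoms M = {r n | n. 1 \<le> n}"
    and "(\<lambda>n. real_of_rat (r n)) \<longlonglongrightarrow> 0"
    and "atomic_monoid M"
  shows "filterlim (\<lambda>n. numer (r n)) at_top sequentially
    \<and> \<not> bdd_above (numer ` atoms M)"
proof -
  have pos: "a > 0" if "a \<in> atoms M" for a
  proof -
    have "a \<in> padic_ambient p" "a \<noteq> 0"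
      using that assms(2) by (auto simp: padic_monoid_def additive_submonoid_def atoms_def)
    then show ?thesis
      using padic_ambient_nonneg[of a p] prime_gt_0_nat[OF assms(1)] by simp
  qed
  \<comment> \<open>The enumeration of atoms starts at index 1, so \<open>r 0\<close> need not be an
    atom.\<close>
  have atom: "r n \<in> atoms M" if "1 \<le> n" for n using that assms(3) by blast
  have lim: "filterlim (\<lambda>n. numer (r n)) at_top sequentially"
    unfolding filterlim_at_top
  proof
    fix Z :: int
    \<comment> \<open>The atoms that the sequence has to leave. Positivity confines their numerators
      to a finite interval, and injectivity of \<open>numer\<close> carries finiteness back to
      \<open>S\<close>.\<close>
    define S where "S = {a \<in> atoms M. numer a < Z}"
    have "numer ` S \<subseteq> {0<..<Z}" using pos numer_pos by (auto simp: S_def)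
    moreover have "inj_on numer S"
      by (rule inj_on_subset[OF inj_on_numer_atoms[OF assms(1,2)]]) (auto simp: S_def)
    ultimately have "finite S" using inj_on_finite by blast
    moreover have "\<forall>\<^sub>F n in sequentially. r n \<noteq> a" if "a \<in> S" for a
    proof -
      \<comment> \<open>A null sequence eventually stays strictly below any fixed positive
        atom.\<close>
      have "0 < real_of_rat a" using that pos by (simp add: S_def)
      then have "\<forall>\<^sub>F n in sequentially. real_of_rat (r n) < real_of_rat a"
        using assms(4) order_tendstoD(2) by blast
      then show ?thesis by eventually_elim auto
    qed
    \<comment> \<open>Finiteness of \<open>S\<close> allows one threshold for all its
      members.\<close>
    ultimately have "\<forall>\<^sub>F n in sequentially. \<forall>a\<in>S. r n \<noteq> a"
      by (simp add: eventually_ball_finite)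
    with eventually_ge_at_top[of 1] show "\<forall>\<^sub>F n in sequentially. Z \<le> numer (r n)"
    proof eventually_elim
      case (elim n)
      then show ?case using atom[of n] by (auto simp: S_def not_less)
    qed
  qed
  have "\<not> bdd_above (numer ` atoms M)"
  proof
    assume "bdd_above (numer ` atoms M)"
    then obtain B where B: "\<And>a. a \<in> atoms M \<Longrightarrow> numer a \<le> B"
      by (auto simp: bdd_above_def)
    \<comment> \<open>Divergence gives an index where the supposed bound \<open>B\<close> is
      exceeded; requiring \<open>1 \<le> n\<close> makes that term an atom.\<close>
    have "\<forall>\<^sub>F n in sequentially. B + 1 \<le> numer (r n) \<and> 1 \<le> n"
      using lim unfolding filterlim_at_top
      by (intro eventually_conj eventually_ge_at_top) blast
    then obtain n where "B + 1 \<le> numer (r n)" "1 \<le> n"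
      using eventually_happens'[OF sequentially_bot] by blast
    then show False using B[OF atom, of n] by simp
  qed
  with lim show ?thesis by blast
qed

end
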